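(* For every integer $\Delta\ge 2$ there exist a $\Delta$-regular graph $G$ and a partition $\mathcal{U}$ of $V(G)$ into blocks each of size at least $2\Delta$ such that the reconfigurability graph of $(G,\mathcal{U})$ is not connected.
   Context: Graphs are finite and simple. Let $G$ be a graph and $\mathcal{U}$ a partition of $V(G)$ (its members are called blocks). An independent transversal of $\mathcal{G}=(G,\mathcal{U})$ is an independent set $S$ of $G$ with $|S\cap U|=1$ for all $U\in\mathcal{U}$; $\operatorname{IT}(\mathcal{G})$ denotes the set of independent transversals of $\mathcal{G}$. The reconfigurability graph of $\mathcal{G}$ has vertex set $\operatorname{IT}(\mathcal{G})$, with $S$ and $T$ adjacent if and only if $S\cup T$ is an independent set of $G$ of size $|\mathcal{U}|+1$ (i.e. $S$ and $T$ agree on all but one block, and on that block their respective vertices are distinct and not adjacent in $G$). *)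

theory Defs
  imports "Graph_Theory.Digraph_Component" "HOL-Library.Disjoint_Sets"
begin

text \<open>
  A finite simple graph is a \<^locale>\<open>pair_graph\<close>: finite vertex set, and an irreflexive
  symmetric set of arcs, so that each edge is represented by its two orientations. In particular,
  the degree of a vertex is its out-degree.
\<close>

definition regular_graph :: "nat \<Rightarrow> 'a pair_pre_digraph \<Rightarrow> bool" where
  "regular_graph d G \<longleftrightarrow> pair_graph G \<and> (\<forall>v\<in>pverts G. out_degree (with_proj G) v = d)"

definition independent_set :: "'a pair_pre_digraph \<Rightarrow> 'a set \<Rightarrow> bool" where
  "independent_set G S \<longleftrightarrow> S \<subseteq> pverts G \<and> (\<forall>u\<in>S. \<forall>v\<in>S. (u, v) \<notin> parcs G)"

definition IT :: "'a pair_pre_digraph \<Rightarrow> 'a set set \<Rightarrow> 'a set set" where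
  "IT G \<U> = {S. independent_set G S \<and> (\<forall>U\<in>\<U>. card (S \<inter> U) = 1)}"

definition reconf_graph :: "'a pair_pre_digraph \<Rightarrow> 'a set set \<Rightarrow> 'a set pair_pre_digraph" where
  "reconf_graph G \<U> =
    \<lparr> pverts = IT G \<U>,
      parcs = {(S, T). S \<in> IT G \<U> \<and> T \<in> IT G \<U> \<and>
        independent_set G (S \<union> T) \<and> card (S \<union> T) = card \<U> + 1} \<rparr>"

lemma card_IT:
  assumes "pair_graph G" "partition_on (pverts G) \<U>" "S \<in> IT G \<U>"
  shows "card S = card \<U>"
proof -
  interpret pair_graph G by fact
  have S: "S \<subseteq> pverts G" "\<And>U. U \<in> \<U> \<Longrightarrow> card (S \<inter> U) = 1"
    using assms(3) by (auto simp: IT_def independent_set_def)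
  have fin: "finite S" "finite \<U>"
    using S(1) pair_finite_verts finite_subset finite_elements assms(2) by blast+
  have "S = (\<Union>U\<in>\<U>. S \<inter> U)"
    using S(1) partition_onD1[OF assms(2)] by auto
  then have "card S = card (\<Union>U\<in>\<U>. S \<inter> U)" by simp
  also have "\<dots> = (\<Sum>U\<in>\<U>. card (S \<inter> U))"
    using fin partition_onD2[OF assms(2)]
    by (intro card_UN_disjoint) (auto simp: disjoint_def)
  also have "\<dots> = card \<U>" using S(2) by simp
  finally show ?thesis .
qed

lemma pair_graph_reconf_graph:
  assumes "pair_graph G" "partition_on (pverts G) \<U>"
  shows "pair_graph (reconf_graph G \<U>)"
proof -
  interpret pair_graph G by fact
  have fin: "finite (IT G \<U>)"
    by (rule finite_subset[of _ "Pow (pverts G)"])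
       (auto simp: IT_def independent_set_def pair_finite_verts)
  have fin_arcs: "finite (parcs (reconf_graph G \<U>))"
    by (rule finite_subset[of _ "IT G \<U> \<times> IT G \<U>"]) (auto simp: reconf_graph_def fin)
  show ?thesis
    by unfold_locales
       (use fin fin_arcs card_IT[OF assms] in
         \<open>auto simp: reconf_graph_def symmetric_def sym_def Un_commute\<close>)
qed

end

theory Submission
  imports Defs
begin

text \<open>
  For a single block the independent transversals are the single vertices, and the
  reconfigurability graph is the complement of \<open>G\<close>. So it suffices to take
  \<open>G = K\<^bsub>\<Delta>,\<Delta>\<^esub>\<close>, whose complement is disconnected, with one block of size \<open>2\<Delta>\<close>.
\<close>

definition complete_bipartite :: "nat \<Rightarrow> nat pair_pre_digraph" where
  "complete_bipartite d =
    \<lparr> pverts = {..<2 * d}, parcs = {(u, v). u < 2 * d \<and> v < 2 * d \<and> (u < d) \<noteq> (v < d)} \<rparr>"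

lemma pair_graph_complete_bipartite: "pair_graph (complete_bipartite d)"
proof -
  have "finite (parcs (complete_bipartite d))"
    by (rule finite_subset[of _ "{..<2 * d} \<times> {..<2 * d}"]) (auto simp: complete_bipartite_def)
  then show ?thesis
    by unfold_locales (auto simp: complete_bipartite_def symmetric_def sym_def)
qed

lemma regular_complete_bipartite: "regular_graph d (complete_bipartite d)"
proof -
  have "out_degree (with_proj (complete_bipartite d)) v = d" if "v < 2 * d" for v
  proof -
    \<comment> \<open>The arcs leaving \<open>v\<close> correspond to the opposite side, and both
      sides have \<open>d\<close> elements.\<close>
    have "out_arcs (with_proj (complete_bipartite d)) v
        = Pair v ` (if v < d then {d..<2 * d} else {..<d})"
      using that by (auto simp: out_arcs_def complete_bipartite_def)
    then show ?thesis
      by (simp add: out_degree_def card_image inj_on_def)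
  qed
  then show ?thesis
    using pair_graph_complete_bipartite by (simp add: regular_graph_def complete_bipartite_def)
qed

lemma singleton_in_IT:
  assumes "pair_graph G" "v \<in> pverts G"
  shows "{v} \<in> IT G {pverts G}"
proof -
  interpret pair_graph G by fact
  show ?thesis
    using assms(2) by (auto simp: IT_def independent_set_def dest: pair_no_loops)
qed

text \<open>A vertex below \<open>d\<close> is adjacent to the whole other side, so an independent
  set containing it cannot leave the lower side.\<close>

lemma complete_bipartite_independent_subset:
  assumes "independent_set (complete_bipartite d) S" "S \<inter> {..<d} \<noteq> {}"
  shows "S \<subseteq> {..<d}"
  using assms by (fastforce simp: independent_set_def complete_bipartite_def)

lemma reconf_graph_complete_bipartite_disconnected:
  assumes "d > 0"
  defines "G \<equiv> complete_bipartite d"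
  shows "\<not> Digraph_Component.connected (with_proj (reconf_graph G {pverts G}))"
    (is "\<not> Digraph_Component.connected ?R")
proof
  assume "Digraph_Component.connected ?R"
  moreover have "{0} \<in> IT G {pverts G}" "{d} \<in> IT G {pverts G}"
    unfolding G_def
    by (intro singleton_in_IT pair_graph_complete_bipartite,
        simp add: complete_bipartite_def assms(1))+
  \<comment> \<open>\<open>connected\<close> means strong connectivity of the symmetric closure,
    hence \<open>mk_symmetric\<close>.\<close>
  ultimately have reach: "{0} \<rightarrow>\<^sup>*\<^bsub>with_proj (mk_symmetric ?R)\<^esub> {d}"
    by (auto simp: Digraph_Component.connected_def strongly_connected_def reconf_graph_def)
  interpret wf_digraph "with_proj (mk_symmetric ?R)"
    by unfold_locales (auto simp: parcs_mk_symmetric reconf_graph_def)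
  \<comment> \<open>Meeting the lower side is an invariant of walks starting at \<open>{0}\<close>,
    but it fails for \<open>{d}\<close>.\<close>
  from reach have "{d} \<inter> {..<d} \<noteq> {}"
  proof (induction rule: reachable_induct)
    case base
    show ?case using assms(1) by auto
  next
    case (step S T)
    \<comment> \<open>The arc may come from either orientation; the condition on
      \<open>S \<union> T\<close> is symmetric.\<close>
    then have "independent_set G (S \<union> T)" "T \<in> IT G {pverts G}"
      by (auto simp: parcs_mk_symmetric reconf_graph_def Un_commute)
    \<comment> \<open>\<open>T\<close> is nonempty because it meets the only block in exactly one
      vertex.\<close>
    then have "S \<union> T \<subseteq> {..<d}" "T \<noteq> {}"
      using step.IH complete_bipartite_independent_subset[of d "S \<union> T"]
      by (auto simp: G_def IT_def)
    then show ?case by auto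
  qed
  then show False by simp
qed

theorem mainTheorem3:
  fixes \<Delta> :: nat
  assumes "\<Delta> \<ge> 2"
  shows "\<exists>(G :: nat pair_pre_digraph) \<U>.
           regular_graph \<Delta> G \<and>
           partition_on (pverts G) \<U> \<and>
           (\<forall>U\<in>\<U>. card U \<ge> 2 * \<Delta>) \<and>
           \<not> Digraph_Component.connected (with_proj (reconf_graph G \<U>))"
proof (intro exI conjI)
  let ?G = "complete_bipartite \<Delta>"
  show "regular_graph \<Delta> ?G" by (rule regular_complete_bipartite)
  \<comment> \<open>Blocks must be nonempty, which holds here as \<open>\<Delta>\<close> is
    positive.\<close>
  show "partition_on (pverts ?G) {pverts ?G}"
    using assms by (intro partition_on_space) (auto simp: complete_bipartite_def lessThan_empty_iff bot_nat_def)
  show "\<forall>U\<in>{pverts ?G}. card U \<ge> 2 * \<Delta>" by (simp add: complete_bipartite_def)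
  show "\<not> Digraph_Component.connected (with_proj (reconf_graph ?G {pverts ?G}))"
    using assms by (intro reconf_graph_complete_bipartite_disconnected) simp
qed

end
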